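(* Let $\mathcal{T}$ be a random dynamical system on $X$ over $(\Omega,\mathcal{B}(\Omega),\mathbb{P},\vartheta)$ with a stationary measure $\mu$. Then for $\mu$-almost every $x\in X$ \[\underline{\mathbf{R}}(x)\leq\underline{d}_\mu(x)\qquad\text{and}\qquad\overline{\mathbf{R}}(x)\leq\overline{d}_\mu(x).\]
   Context: Random dynamical system: $\Omega$ is a metric space with Borel $\sigma$-algebra $\mathcal{B}(\Omega)$, $\mathbb{P}$ is a probability measure on $(\Omega,\mathcal{B}(\Omega))$, and $\vartheta:\Omega\to\Omega$ is a measurable $\mathbb{P}$-preserving map. $X$ is a compact Riemannian manifold with distance $d$, and $B(x,r)$ denotes the open ball. A family of maps $T_\omega:X\to X$, $\omega\in\Omega$, is given such that $(\omega,x)\mapsto T_\omega x$ is measurable. For $n\ge 1$ set $T^n_\omega:=T_{\vartheta^{n-1}\omega}\circ\cdots\circ T_{\vartheta\omega}\circ T_\omega$ (and $T^0_\omega=\mathrm{id}$), so that $T^{n+m}_\omega=T^n_{\vartheta^m\omega}\circ T^m_\omega$. These data form the random dynamical system $\mathcal{T}$ on $X$ over $(\Omega,\mathcal{B}(\Omega),\mathbb{P},\vartheta)$. Stationary measure: the skew product is $S:\Omega\times X\to\Omega\times X$, $S(\omega,x)=(\vartheta\omega,T_\omega x)$. A Borel probability measure $\mu$ on $X$ is stationary if $\mathbb{P}\otimes\mu$ is $S$-invariant. Non-instantaneous annealed return times and recurrence rates: for $r>0$, $p\in\mathbb{N}=\{0,1,2,\dots\}$, \[\tau^{\omega}_{r,p}(x):=\inf\{k>p: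 d(T^k_\omega x,x)<r\},\qquad \mathbf{T}_{r,p}(x):=\int_\Omega\tau^{\omega}_{r,p}(x)\,d\mathbb{P}(\omega)\] (with $\inf\emptyset=+\infty$, $\log(+\infty)=+\infty$), and \[\underline{\mathbf{R}}(x):=\lim_{p\to\infty}\liminf_{r\to0}\frac{\log\mathbf{T}_{r,p}(x)}{-\log r},\qquad \overline{\mathbf{R}}(x):=\lim_{p\to\infty}\limsup_{r\to0}\frac{\log\mathbf{T}_{r,p}(x)}{-\log r}.\] Local dimensions: $\underline{d}_\mu(x)=\liminf_{r\to0}\frac{\log\mu(B(x,r))}{\log r}$ and $\overline{d}_\mu(x)=\limsup_{r\to0}\frac{\log\mu(B(x,r))}{\log r}$. *)

theory Defs
  imports "HOL-Probability.Probability"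
begin

section \<open>Compact Riemannian manifolds\<close>

text \<open>On an open set, the following is the usual notion of a $C^k$ map, expressed through
  iterated directional derivatives (so that the codomain does not change with the order).\<close>

fun C_k_on :: "nat \<Rightarrow> ('a::real_normed_vector \<Rightarrow> 'b::real_normed_vector) \<Rightarrow> 'a set \<Rightarrow> bool" where
  "C_k_on 0 f S \<longleftrightarrow> continuous_on S f"
| "C_k_on (Suc k) f S \<longleftrightarrow>
     (\<forall>x\<in>S. f differentiable (at x)) \<and> (\<forall>v. C_k_on k (\<lambda>x. frechet_derivative f (at x) v) S)"

definition C_infinity_on :: "('a::real_normed_vector \<Rightarrow> 'b::real_normed_vector) \<Rightarrow> 'a set \<Rightarrow> bool" where
  "C_infinity_on f S \<longleftrightarrow> (\<forall>k. C_k_on k f S)"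

text \<open>A chart is a pair of a domain and a coordinate map; only the values of the coordinate map
  on the domain are relevant.\<close>

type_synonym ('a, 'e) chart = "'a set \<times> ('a \<Rightarrow> 'e)"

definition chart_inv :: "('a, 'e) chart \<Rightarrow> 'e \<Rightarrow> 'a" where
  "chart_inv c = inv_into (fst c) (snd c)"

definition transition :: "('a, 'e) chart \<Rightarrow> ('a, 'e) chart \<Rightarrow> 'e \<Rightarrow> 'e" where
  "transition c c' = snd c' \<circ> chart_inv c"

definition is_chart :: "('a::topological_space, 'e::euclidean_space) chart \<Rightarrow> bool" where
  "is_chart c \<longleftrightarrow> open (fst c) \<and> open (snd c ` fst c) \<and>
     homeomorphism (fst c) (snd c ` fst c) (snd c) (chart_inv c)"

definition smooth_atlas :: "('a::topological_space, 'e::euclidean_space) chart set \<Rightarrow> bool" where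
  "smooth_atlas \<A> \<longleftrightarrow> (\<forall>c\<in>\<A>. is_chart c) \<and> (\<Union>c\<in>\<A>. fst c) = UNIV \<and>
     (\<forall>c\<in>\<A>. \<forall>c'\<in>\<A>. C_infinity_on (transition c c') (snd c ` (fst c \<inter> fst c')))"

text \<open>A Riemannian metric is given by its coordinate expressions: \<open>g c x v w\<close> is the inner
  product of the two tangent vectors at \<open>x\<close> whose components in the chart \<open>c\<close> are \<open>v\<close>
  and \<open>w\<close>.\<close>

type_synonym ('a, 'e) metric_tensor = "('a, 'e) chart \<Rightarrow> 'a \<Rightarrow> 'e \<Rightarrow> 'e \<Rightarrow> real"

definition riemannian_metric ::
  "('a::topological_space, 'e::euclidean_space) chart set \<Rightarrow> ('a, 'e) metric_tensor \<Rightarrow> bool" where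
  "riemannian_metric \<A> g \<longleftrightarrow>
     (\<forall>c\<in>\<A>. \<forall>x\<in>fst c. bilinear (g c x) \<and> (\<forall>v w. g c x v w = g c x w v) \<and>
        (\<forall>v. v \<noteq> 0 \<longrightarrow> 0 < g c x v v)) \<and>
     (\<forall>c\<in>\<A>. \<forall>v w. C_infinity_on (\<lambda>y. g c (chart_inv c y) v w) (snd c ` fst c)) \<and>
     (\<forall>c\<in>\<A>. \<forall>c'\<in>\<A>. \<forall>x\<in>fst c \<inter> fst c'. \<forall>v w.
        g c x v w = g c' x (frechet_derivative (transition c c') (at (snd c x)) v)
                           (frechet_derivative (transition c c') (at (snd c x)) w))"

definition C1_curve ::
  "('a::topological_space, 'e::euclidean_space) chart set \<Rightarrow> (real \<Rightarrow> 'a) \<Rightarrow> real \<Rightarrow> real \<Rightarrow> bool" where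
  "C1_curve \<A> \<gamma> a b \<longleftrightarrow> continuous_on {a..b} \<gamma> \<and>
     (\<forall>c\<in>\<A>. \<exists>D. continuous_on {t\<in>{a..b}. \<gamma> t \<in> fst c} D \<and>
        (\<forall>t\<in>{a..b}. \<gamma> t \<in> fst c \<longrightarrow>
           ((snd c \<circ> \<gamma>) has_vector_derivative D t) (at t within {a..b})))"

text \<open>Piecewise $C^1$: after removal of finitely many break points, \<open>\<gamma>\<close> is $C^1$, up to
  the end points, on each closed interval without break points in its interior.\<close>

definition piecewise_C1_curve ::
  "('a::topological_space, 'e::euclidean_space) chart set \<Rightarrow> (real \<Rightarrow> 'a) \<Rightarrow> bool" where
  "piecewise_C1_curve \<A> \<gamma> \<longleftrightarrow> continuous_on {0..1} \<gamma> \<and>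
     (\<exists>F. finite F \<and> (\<forall>a b. 0 \<le> a \<and> a < b \<and> b \<le> 1 \<and> {a<..<b} \<inter> F = {} \<longrightarrow> C1_curve \<A> \<gamma> a b))"

text \<open>By the transformation law of the metric tensor the speed does not depend on the chart chosen.
  The two-sided derivative is missing at finitely many times at most, which does not
  affect the length.\<close>

definition speed ::
  "('a::topological_space, 'e::euclidean_space) chart set \<Rightarrow> ('a, 'e) metric_tensor \<Rightarrow> (real \<Rightarrow> 'a) \<Rightarrow> real \<Rightarrow> real" where
  "speed \<A> g \<gamma> t =
     (let c = (SOME c. c \<in> \<A> \<and> \<gamma> t \<in> fst c); v = vector_derivative (snd c \<circ> \<gamma>) (at t)
      in sqrt (g c (\<gamma> t) v v))"

definition curve_length ::
  "('a::topological_space, 'e::euclidean_space) chart set \<Rightarrow> ('a, 'e) metric_tensor \<Rightarrow> (real \<Rightarrow> 'a) \<Rightarrow> real" where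
  "curve_length \<A> g \<gamma> = integral {0..1} (speed \<A> g \<gamma>)"

definition curves_between ::
  "('a::topological_space, 'e::euclidean_space) chart set \<Rightarrow> 'a \<Rightarrow> 'a \<Rightarrow> (real \<Rightarrow> 'a) set" where
  "curves_between \<A> x y = {\<gamma>. piecewise_C1_curve \<A> \<gamma> \<and> \<gamma> 0 = x \<and> \<gamma> 1 = y}"

text \<open>The distance of the metric space is the Riemannian one. If the manifold is connected, any
  two points are joined by a curve, and the last condition determines the distance. If it
  is not connected, there is no canonical distance between points of different
  components, and none is prescribed beyond being part of a metric for the topology.\<close>

definition compact_riemannian_manifold ::
  "('a::metric_space, 'e::euclidean_space) chart set \<Rightarrow> ('a, 'e) metric_tensor \<Rightarrow> bool" where
  "compact_riemannian_manifold \<A> g \<longleftrightarrow>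
     compact (UNIV :: 'a set) \<and> smooth_atlas \<A> \<and> riemannian_metric \<A> g \<and>
     (\<forall>x y. curves_between \<A> x y \<noteq> {} \<longrightarrow>
        dist x y = (INF \<gamma>\<in>curves_between \<A> x y. curve_length \<A> g \<gamma>))"

section \<open>Random dynamical systems and stationary measures\<close>

definition random_dynamical_system ::
  "'w::metric_space measure \<Rightarrow> ('w \<Rightarrow> 'w) \<Rightarrow> ('w \<Rightarrow> 'x::topological_space \<Rightarrow> 'x) \<Rightarrow> bool" where
  "random_dynamical_system P \<theta> T \<longleftrightarrow>
     prob_space P \<and> sets P = sets borel \<and>
     \<theta> \<in> measurable P P \<and> distr P P \<theta> = P \<and>
     (\<lambda>(\<omega>, x). T \<omega> x) \<in> measurable (P \<Otimes>\<^sub>M borel) borel"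

fun cocycle :: "('w \<Rightarrow> 'w) \<Rightarrow> ('w \<Rightarrow> 'x \<Rightarrow> 'x) \<Rightarrow> nat \<Rightarrow> 'w \<Rightarrow> 'x \<Rightarrow> 'x" where
  "cocycle \<theta> T 0 \<omega> = id"
| "cocycle \<theta> T (Suc n) \<omega> = T ((\<theta> ^^ n) \<omega>) \<circ> cocycle \<theta> T n \<omega>"

definition skew_product :: "('w \<Rightarrow> 'w) \<Rightarrow> ('w \<Rightarrow> 'x \<Rightarrow> 'x) \<Rightarrow> 'w \<times> 'x \<Rightarrow> 'w \<times> 'x" where
  "skew_product \<theta> T = (\<lambda>(\<omega>, x). (\<theta> \<omega>, T \<omega> x))"

definition stationary_measure ::
  "'w measure \<Rightarrow> ('w \<Rightarrow> 'w) \<Rightarrow> ('w \<Rightarrow> 'x::topological_space \<Rightarrow> 'x) \<Rightarrow> 'x measure \<Rightarrow> bool" where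
  "stationary_measure P \<theta> T \<mu> \<longleftrightarrow>
     prob_space \<mu> \<and> sets \<mu> = sets borel \<and>
     distr (P \<Otimes>\<^sub>M \<mu>) (P \<Otimes>\<^sub>M \<mu>) (skew_product \<theta> T) = P \<Otimes>\<^sub>M \<mu>"

section \<open>Recurrence rates and local dimensions\<close>

definition ext_ln :: "ennreal \<Rightarrow> ereal" where
  "ext_ln t = (if t = 0 then -\<infinity> else if t = \<infinity> then \<infinity> else ereal (ln (enn2real t)))"

text \<open>The infimum of the empty set is \<open>\<infinity>\<close>.\<close>

definition return_time ::
  "('w \<Rightarrow> 'w) \<Rightarrow> ('w \<Rightarrow> 'x::metric_space \<Rightarrow> 'x) \<Rightarrow> real \<Rightarrow> nat \<Rightarrow> 'w \<Rightarrow> 'x \<Rightarrow> ennreal" where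
  "return_time \<theta> T r p \<omega> x = (INF k\<in>{k. k > p \<and> dist (cocycle \<theta> T k \<omega> x) x < r}. of_nat k)"

definition annealed_return_time ::
  "'w measure \<Rightarrow> ('w \<Rightarrow> 'w) \<Rightarrow> ('w \<Rightarrow> 'x::metric_space \<Rightarrow> 'x) \<Rightarrow> real \<Rightarrow> nat \<Rightarrow> 'x \<Rightarrow> ennreal" where
  "annealed_return_time P \<theta> T r p x = (\<integral>\<^sup>+\<omega>. return_time \<theta> T r p \<omega> x \<partial>P)"

text \<open>The limits over \<open>p\<close> exist in the extended reals by monotonicity in \<open>p\<close>.\<close>

definition lower_recurrence_rate ::
  "'w measure \<Rightarrow> ('w \<Rightarrow> 'w) \<Rightarrow> ('w \<Rightarrow> 'x::metric_space \<Rightarrow> 'x) \<Rightarrow> 'x \<Rightarrow> ereal" where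
  "lower_recurrence_rate P \<theta> T x =
     lim (\<lambda>p. Liminf (at_right 0) (\<lambda>r. ext_ln (annealed_return_time P \<theta> T r p x) / ereal (- ln r)))"

definition upper_recurrence_rate ::
  "'w measure \<Rightarrow> ('w \<Rightarrow> 'w) \<Rightarrow> ('w \<Rightarrow> 'x::metric_space \<Rightarrow> 'x) \<Rightarrow> 'x \<Rightarrow> ereal" where
  "upper_recurrence_rate P \<theta> T x =
     lim (\<lambda>p. Limsup (at_right 0) (\<lambda>r. ext_ln (annealed_return_time P \<theta> T r p x) / ereal (- ln r)))"

definition lower_local_dim :: "'x::metric_space measure \<Rightarrow> 'x \<Rightarrow> ereal" where
  "lower_local_dim \<mu> x = Liminf (at_right 0) (\<lambda>r. ext_ln (emeasure \<mu> (ball x r)) / ereal (ln r))"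

definition upper_local_dim :: "'x::metric_space measure \<Rightarrow> 'x \<Rightarrow> ereal" where
  "upper_local_dim \<mu> x = Limsup (at_right 0) (\<lambda>r. ext_ln (emeasure \<mu> (ball x r)) / ereal (ln r))"

end

theory Submission
  imports Defs "HOL-Real_Asymp.Real_Asymp"
begin

text \<open>
  The skew product preserves \<open>P \<Otimes> \<mu>\<close>. An argument in the spirit of Kac's lemma shows that the
  first return after time \<open>p\<close> to a set \<open>A\<close>, integrated over \<open>A\<close>, is at most \<open>p + 1\<close>
  (\<open>nn_integral_late_return_time_le\<close>). For \<open>A = \<Omega> \<times> B(y, s)\<close> a return to \<open>A\<close> brings a point of
  \<open>B(y, s)\<close> back to within \<open>2 s\<close> of itself, so the integral of the annealed return time
  over \<open>B(y, s)\<close> is at most \<open>p + 1\<close> as well. By Markov's inequality this return time is, for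
  most points of the ball, not much larger than the inverse of the mass of the ball.

  To pass from one ball to the whole space one adds the exceptional sets over a cover by
  balls. The sum stays small if only those points \<open>x\<close> have to be covered at which the mass of
  \<open>B(x, 2 s)\<close> is at most \<open>K\<close> times the mass of \<open>B(x, s / 2)\<close>: with centres that are \<open>s\<close>-separated
  the small balls are disjoint and their masses add up to at most \<open>1\<close>
  (\<open>small_exceptional_set\<close>). Borel and Cantelli then give, for almost every \<open>x\<close>, a bound by the
  inverse mass at all sufficiently small dyadic scales that are doubling at \<open>x\<close>
  (\<open>AE_return_time_at_doubling_scales\<close>).

  The rest concerns a single such point. Recurrence rates and dimensions are logarithmic, so
  it costs only a factor \<open>c\<close>, arbitrarily close to \<open>1\<close>, to replace a radius \<open>r\<close> by \<open>r powr c\<close>.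
  The number of dyadic scales between these two radii is proportional to \<open>- ln r\<close>. If \<open>K\<close> is large
  and none of them is doubling, then the mass of \<open>B(x, r powr c)\<close> is below \<open>r powr (c * D)\<close>
  (\<open>doubling_scale_exists\<close>). Hence, if \<open>r\<close> is small and the dimension quotient
  at \<open>r powr c\<close> is less than \<open>D\<close>, there is a doubling scale in between, and it bounds the recurrence
  quotient at \<open>r\<close> by about \<open>c * D\<close> (\<open>eventually_return_rate_le\<close>). As this compares the two quotients
  radius by radius, it yields the inequality for the lower limits and for the upper ones.
\<close>

section \<open>The mean of late return times\<close>

definition late_visit_time :: "('a \<Rightarrow> 'a) \<Rightarrow> 'a set \<Rightarrow> nat \<Rightarrow> 'a \<Rightarrow> ennreal" where
  "late_visit_time S A p z = (INF k\<in>{k. k > p \<and> (S ^^ k) z \<in> A}. of_nat k)"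

text \<open>A layer-cake formula: it turns the integral of a first visit time into a sum of measures,
  and it shows at once that such a time is measurable.\<close>

lemma INF_of_nat_eq_suminf:
  "(INF k\<in>K. of_nat k :: ennreal) = (\<Sum>n. if \<forall>k\<in>K. n < k then 1 else 0)"
proof (cases "K = {}")
  case True
  have "of_nat n \<le> (\<Sum>n. 1 :: ennreal)" for n :: nat
    using sum_le_suminf[of "\<lambda>_. 1 :: ennreal" "{..<n}"] by simp
  then have "(\<Sum>n. 1 :: ennreal) = top"
    by (metis ennreal_Ex_less_of_nat less_top linorder_not_le)
  then show ?thesis
    using True by simp
next
  case False
  define m where "m = (LEAST k. k \<in> K)"
  have m: "m \<in> K" "\<And>k. k \<in> K \<Longrightarrow> m \<le> k"
    using False unfolding m_def by (auto intro: LeastI Least_le)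
  have iff: "(\<forall>k\<in>K. n < k) \<longleftrightarrow> n < m" for n
    using m by (meson less_le_trans)
  have "(INF k\<in>K. of_nat k :: ennreal) = of_nat m"
    using m by (intro antisym INF_lower INF_greatest) auto
  also have "\<dots> = (\<Sum>n\<in>{..<m}. if \<forall>k\<in>K. n < k then 1 else 0 :: ennreal)"
    by (simp add: iff)
  also have "\<dots> = (\<Sum>n. if \<forall>k\<in>K. n < k then 1 else 0)"
    by (intro suminf_finite[symmetric]) (auto simp: iff)
  finally show ?thesis .
qed

lemma late_visit_time_eq_suminf:
  "late_visit_time S A p z = (\<Sum>n. indicator {z. \<forall>k. p < k \<and> k \<le> n \<longrightarrow> (S ^^ k) z \<notin> A} z)"
proof -
  have "(\<forall>k\<in>{k. k > p \<and> (S ^^ k) z \<in> A}. n < k) \<longleftrightarrow>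
        (\<forall>k. p < k \<and> k \<le> n \<longrightarrow> (S ^^ k) z \<notin> A)" for n
    by (auto simp: not_le)
  then show ?thesis
    unfolding late_visit_time_def INF_of_nat_eq_suminf by (auto simp: indicator_def intro!: suminf_cong)
qed

lemma measurable_late_visit_time [measurable]:
  assumes [measurable]: "S \<in> measurable M M" "A \<in> sets M"
  shows "late_visit_time S A p \<in> borel_measurable M"
  unfolding late_visit_time_eq_suminf[abs_def] indicator_def mem_Collect_eq
  by measurable

lemma distr_funpow:
  assumes [measurable]: "S \<in> measurable M M" and "distr M M S = M"
  shows "distr M M (S ^^ n) = M"
proof (induction n)
  case 0
  then show ?case by (simp add: distr_id id_def)
next
  case (Suc n)
  have "distr M M (S ^^ Suc n) = distr (distr M M (S ^^ n)) M S"
    by (subst distr_distr) simp_all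
  also have "\<dots> = M"
    by (simp only: Suc assms(2))
  finally show ?case .
qed

text \<open>Let \<open>E n\<close> be the set of points of \<open>A\<close> without a visit to \<open>A\<close> at the times from \<open>p + 1\<close> to \<open>n\<close>;
  the integral is the sum of the measures of these sets. Invariance allows to pull \<open>E n\<close> back along
  \<open>S ^^ (N - n)\<close>. The preimage consists of the orbits that visit \<open>A\<close> at time \<open>N - n\<close> and then not
  between \<open>p + 1\<close> steps later and time \<open>N\<close>, so a given orbit can be in at most \<open>p + 1\<close> of the preimages
  for \<open>n < N\<close>.\<close>

lemma (in prob_space) nn_integral_late_return_time_le:
  assumes S [measurable]: "S \<in> measurable M M" and invariant: "distr M M S = M"
    and A [measurable]: "A \<in> sets M"
  shows "(\<integral>\<^sup>+z. late_visit_time S A p z * indicator A z \<partial>M) \<le> of_nat (Suc p)"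
proof -
  define E where "E n = {z \<in> space M. z \<in> A \<and> (\<forall>k\<in>{p<..n}. (S ^^ k) z \<notin> A)}" for n
  have E [measurable]: "E n \<in> sets M" for n
    unfolding E_def by measurable
  have count: "(\<Sum>n<N. indicator (E n) ((S ^^ (N - n)) z)) \<le> (of_nat (Suc p) :: ennreal)" for N z
  proof -
    define J where "J = {n. n < N \<and> (S ^^ (N - n)) z \<in> E n}"
    have "finite J"
      unfolding J_def by simp
    have "card J \<le> Suc p"
    proof (cases "J = {}")
      case False
      define m where "m = Max J"
      have m: "m \<in> J" "\<And>n. n \<in> J \<Longrightarrow> n \<le> m"
        using False \<open>finite J\<close> by (auto simp: m_def)
      \<comment> \<open>The time \<open>N - m\<close> is the earliest counted visit; at every later counted visit the
        orbit is again in \<open>A\<close>, hence it comes at most \<open>p\<close> steps later.\<close>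
      have "m - p \<le> n" if "n \<in> J" for n
      proof (rule ccontr)
        assume "\<not> m - p \<le> n"
        then have "n < m" "p < m - n" "m - n \<le> m" by auto
        moreover have "N - n = (m - n) + (N - m)"
          using \<open>n < m\<close> m(1) by (auto simp: J_def)
        then have "(S ^^ (m - n)) ((S ^^ (N - m)) z) \<in> A"
          using that by (simp add: J_def E_def funpow_add)
        ultimately show False
          using m(1) by (auto simp: J_def E_def)
      qed
      with m(2) have "J \<subseteq> {m - p..m}" by auto
      then have "card J \<le> card {m - p..m}"
        by (intro card_mono) auto
      then show ?thesis by simp
    qed simp
    moreover have "(\<Sum>n<N. indicator (E n) ((S ^^ (N - n)) z)) = (of_nat (card J) :: ennreal)"
      unfolding J_def indicator_def by (subst sum_of_bool_eq) (auto intro!: arg_cong[where f=card])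
    ultimately show ?thesis
      by (metis of_nat_mono)
  qed
  have partial: "(\<Sum>n<N. emeasure M (E n)) \<le> of_nat (Suc p)" for N
  proof -
    have "emeasure M (E n) = (\<integral>\<^sup>+z. indicator (E n) ((S ^^ (N - n)) z) \<partial>M)" for n
    proof -
      have "emeasure M (E n) = (\<integral>\<^sup>+z. indicator (E n) z \<partial>distr M M (S ^^ (N - n)))"
        by (simp add: distr_funpow[OF S invariant])
      also have "\<dots> = (\<integral>\<^sup>+z. indicator (E n) ((S ^^ (N - n)) z) \<partial>M)"
        by (rule nn_integral_distr) measurable
      finally show ?thesis .
    qed
    then have "(\<Sum>n<N. emeasure M (E n)) = (\<integral>\<^sup>+z. (\<Sum>n<N. indicator (E n) ((S ^^ (N - n)) z)) \<partial>M)"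
      by (subst nn_integral_sum) simp_all
    also have "\<dots> \<le> (\<integral>\<^sup>+z. of_nat (Suc p) \<partial>M)"
      by (intro nn_integral_mono count)
    finally show ?thesis
      by (simp add: emeasure_space_1)
  qed
  have "(\<integral>\<^sup>+z. late_visit_time S A p z * indicator A z \<partial>M) = (\<integral>\<^sup>+z. (\<Sum>n. indicator (E n) z) \<partial>M)"
  proof (rule nn_integral_cong)
    fix z assume "z \<in> space M"
    then have "indicator {z. \<forall>k. p < k \<and> k \<le> n \<longrightarrow> (S ^^ k) z \<notin> A} z * indicator A z
        = (indicator (E n) z :: ennreal)" for n
      by (auto simp: E_def indicator_def)
    then show "late_visit_time S A p z * indicator A z = (\<Sum>n. indicator (E n) z)"
      unfolding late_visit_time_eq_suminf by (subst ennreal_suminf_multc[symmetric]) simp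
  qed
  also have "\<dots> = (\<Sum>n. emeasure M (E n))"
    by (subst nn_integral_suminf) simp_all
  also have "\<dots> \<le> of_nat (Suc p)"
    using partial by (intro suminf_le_const) simp_all
  finally show ?thesis .
qed


section \<open>Annealed return times at doubling scales\<close>

text \<open>Total boundedness limits the cardinality of separated sets; one of maximal cardinality is
  a net.\<close>

lemma compact_imp_finite_separated_net:
  fixes G :: "'a::metric_space set"
  assumes "compact U" "G \<subseteq> U" "0 < s"
  obtains F where "finite F" "F \<subseteq> G" "\<And>x y. x \<in> F \<Longrightarrow> y \<in> F \<Longrightarrow> x \<noteq> y \<Longrightarrow> s \<le> dist x y"
    "G \<subseteq> (\<Union>x\<in>F. ball x s)"
proof -
  define sep where "sep F \<longleftrightarrow> F \<subseteq> G \<and> (\<forall>x\<in>F. \<forall>y\<in>F. x \<noteq> y \<longrightarrow> s \<le> dist x y)" for F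
  obtain C where C: "finite C" "U \<subseteq> (\<Union>c\<in>C. ball c (s / 2))"
    using assms by (auto simp: compact_eq_totally_bounded dest!: spec[of _ "s / 2"])
  have bound: "card F < Suc (card C)" if "sep F" for F
  proof -
    have "\<forall>x\<in>F. \<exists>c\<in>C. dist c x < s / 2"
      using that C(2) \<open>G \<subseteq> U\<close> by (fastforce simp: sep_def)
    then obtain c where c: "\<And>x. x \<in> F \<Longrightarrow> c x \<in> C \<and> dist (c x) x < s / 2"
      by metis
    have "inj_on c F"
    proof (rule inj_onI, rule ccontr)
      fix x y assume xy: "x \<in> F" "y \<in> F" "c x = c y" "x \<noteq> y"
      have "dist x y < s"
        using dist_triangle3[of x y "c x"] c[OF xy(1)] c[OF xy(2)] xy(3) by simp
      moreover have "s \<le> dist x y"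
        using that xy unfolding sep_def by blast
      ultimately show False by simp
    qed
    then have "card F \<le> card C"
      using c C(1) by (intro card_inj_on_le[of c]) auto
    then show ?thesis by simp
  qed
  have "sep {} \<and> finite {}"
    by (simp add: sep_def)
  then obtain F where F: "sep F" "finite F" "\<And>F'. sep F' \<and> finite F' \<Longrightarrow> card F' \<le> card F"
    using bound Max_ge ex_has_greatest_nat[of "\<lambda>F. sep F \<and> finite F" "{}" card "Suc (card C)"]
    by blast
  have "x \<in> (\<Union>y\<in>F. ball y s)" if "x \<in> G" for x
  proof (rule ccontr)
    assume "x \<notin> (\<Union>y\<in>F. ball y s)"
    then have far: "s \<le> dist y x" if "y \<in> F" for y
      using that by (auto simp: not_less)
    then have "x \<notin> F"
      using \<open>0 < s\<close> by force
    moreover have "sep (insert x F)"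
      using F(1) far \<open>x \<in> G\<close> by (auto simp: sep_def dist_commute)
    ultimately show False
      using F(2) F(3)[of "insert x F"] by simp
  qed
  then show ?thesis
    using F by (intro that[of F]) (auto simp: sep_def)
qed

lemma skew_product_funpow:
  "(skew_product \<theta> T ^^ n) (\<omega>, x) = ((\<theta> ^^ n) \<omega>, cocycle \<theta> T n \<omega> x)"
  by (induction n) (simp_all add: skew_product_def)

text \<open>The return time compares the orbit with its own moving starting point, which makes it
  awkward for the invariant measure. Inside a fixed ball it is dominated by the time of a visit to a
  fixed set.\<close>

lemma return_time_le_late_visit_time:
  assumes "x \<in> ball y s"
  shows "return_time \<theta> T (2 * s) p \<omega> x \<le> late_visit_time (skew_product \<theta> T) (UNIV \<times> ball y s) p (\<omega>, x)"
  unfolding return_time_def late_visit_time_def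
proof (rule INF_superset_mono)
  show "{k. p < k \<and> (skew_product \<theta> T ^^ k) (\<omega>, x) \<in> UNIV \<times> ball y s}
      \<subseteq> {k. p < k \<and> dist (cocycle \<theta> T k \<omega> x) x < 2 * s}"
  proof
    fix k assume "k \<in> {k. p < k \<and> (skew_product \<theta> T ^^ k) (\<omega>, x) \<in> UNIV \<times> ball y s}"
    then show "k \<in> {k. p < k \<and> dist (cocycle \<theta> T k \<omega> x) x < 2 * s}"
      using assms dist_triangle3[of "cocycle \<theta> T k \<omega> x" x y] by (simp add: skew_product_funpow)
  qed
qed simp

locale stationary_rds =
  fixes P :: "'w::metric_space measure"
    and \<theta> :: "'w \<Rightarrow> 'w"
    and T :: "'w \<Rightarrow> 'x::metric_space \<Rightarrow> 'x"
    and \<mu> :: "'x measure"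
  assumes rds: "random_dynamical_system P \<theta> T"
    and stationary: "stationary_measure P \<theta> T \<mu>"
begin

sublocale P: prob_space P
  using rds by (simp add: random_dynamical_system_def)

sublocale \<mu>: prob_space \<mu>
  using stationary by (simp add: stationary_measure_def)

sublocale P\<mu>: pair_prob_space P \<mu> ..

lemma sets_P [measurable_cong]: "sets P = sets borel"
  using rds by (simp add: random_dynamical_system_def)

lemma sets_\<mu> [measurable_cong]: "sets \<mu> = sets borel"
  using stationary by (simp add: stationary_measure_def)

lemma measurable_skew_product [measurable]:
  "skew_product \<theta> T \<in> measurable (P \<Otimes>\<^sub>M \<mu>) (P \<Otimes>\<^sub>M \<mu>)"
proof -
  have [measurable]: "\<theta> \<in> measurable P P" "(\<lambda>(\<omega>, x). T \<omega> x) \<in> measurable (P \<Otimes>\<^sub>M borel) borel"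
    using rds by (simp_all add: random_dynamical_system_def)
  have "(\<lambda>(\<omega>, x). T \<omega> x) \<in> measurable (P \<Otimes>\<^sub>M \<mu>) \<mu>"
    by measurable
  then show ?thesis
    unfolding skew_product_def by (simp add: case_prod_beta')
qed

text \<open>The exceptional set is a union over an \<open>s\<close>-separated net of the doubling points. In each ball
  \<open>B(y, s)\<close> Markov's inequality is applied with the threshold \<open>K / (a * \<mu> (B(y, 2 s)))\<close>. The
  radius \<open>2 s\<close> in it is what bounds the mass of \<open>B(x, s)\<close> for every \<open>x\<close> in \<open>B(y, s)\<close>; doubling at \<open>y\<close>
  brings the resulting estimate down to the mass of \<open>B(y, s / 2)\<close>, and these balls are
  disjoint.\<close>

lemma small_exceptional_set:
  assumes compact: "compact (UNIV :: 'x set)" and "0 < s" "0 < K" "0 < a"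
  obtains B where "B \<in> sets \<mu>" "emeasure \<mu> B \<le> ennreal (a * real (Suc p))"
    and "\<And>x. x \<notin> B \<Longrightarrow> emeasure \<mu> (ball x (2 * s)) \<le> ennreal K * emeasure \<mu> (ball x (s / 2)) \<Longrightarrow>
      annealed_return_time P \<theta> T (2 * s) p x * emeasure \<mu> (ball x s) \<le> ennreal (K / a)"
proof -
  let ?S = "skew_product \<theta> T"
  define U where "U y x = (\<integral>\<^sup>+\<omega>. late_visit_time ?S (UNIV \<times> ball y s) p (\<omega>, x) \<partial>P)" for y x
  define c where "c y = ennreal (a / K) * emeasure \<mu> (ball y (2 * s))" for y
  define B where "B y = {x \<in> ball y s. 1 \<le> c y * U y x}" for y
  have balls [measurable]: "ball y r \<in> sets \<mu>" for y r
    by (simp add: sets_\<mu>)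
  have cylinders [measurable]: "UNIV \<times> ball y s \<in> sets (P \<Otimes>\<^sub>M \<mu>)" for y
    by (intro pair_measureI) (simp_all add: sets_P)
  have visit [measurable]: "late_visit_time ?S (UNIV \<times> ball y s) p \<in> borel_measurable (P \<Otimes>\<^sub>M \<mu>)" for y
    by measurable
  have U [measurable]: "U y \<in> borel_measurable \<mu>" for y
    unfolding U_def by measurable
  have "space \<mu> = UNIV"
    using sets_eq_imp_space_eq[OF sets_\<mu>] by simp
  then have B [measurable]: "B y \<in> sets \<mu>" for y
  proof -
    have "B y = ball y s \<inter> {x \<in> space \<mu>. 1 \<le> c y * U y x}"
      using \<open>space \<mu> = UNIV\<close> by (auto simp: B_def)
    then show ?thesis by simp
  qed
  have return: "(\<integral>\<^sup>+x. U y x * indicator (ball y s) x \<partial>\<mu>) \<le> of_nat (Suc p)" for y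
  proof -
    let ?f = "\<lambda>z. late_visit_time ?S (UNIV \<times> ball y s) p z * indicator (UNIV \<times> ball y s) z"
    have "U y x * indicator (ball y s) x = (\<integral>\<^sup>+\<omega>. ?f (\<omega>, x) \<partial>P)" if "x \<in> space \<mu>" for x
      unfolding U_def using that by (subst nn_integral_multc[symmetric]) (auto intro!: nn_integral_cong simp: indicator_def)
    then have "(\<integral>\<^sup>+x. U y x * indicator (ball y s) x \<partial>\<mu>) = (\<integral>\<^sup>+x. (\<integral>\<^sup>+\<omega>. ?f (\<omega>, x) \<partial>P) \<partial>\<mu>)"
      by (intro nn_integral_cong)
    also have "\<dots> = (\<integral>\<^sup>+z. ?f z \<partial>(P \<Otimes>\<^sub>M \<mu>))"
      by (rule P\<mu>.nn_integral_snd) measurable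
    also have "\<dots> \<le> of_nat (Suc p)"
      using stationary by (intro P\<mu>.nn_integral_late_return_time_le) (auto simp: stationary_measure_def)
    finally show ?thesis .
  qed
  define G where "G = {x. emeasure \<mu> (ball x (2 * s)) \<le> ennreal K * emeasure \<mu> (ball x (s / 2))}"
  obtain F where F: "finite F" "F \<subseteq> G" "\<And>x y. x \<in> F \<Longrightarrow> y \<in> F \<Longrightarrow> x \<noteq> y \<Longrightarrow> s \<le> dist x y"
    "G \<subseteq> (\<Union>x\<in>F. ball x s)"
    by (rule compact_imp_finite_separated_net[OF compact subset_UNIV[of G] \<open>0 < s\<close>]) blast
  have disjoint: "disjoint_family_on (\<lambda>y. ball y (s / 2)) F"
    unfolding disjoint_family_on_def
  proof safe
    fix x y z assume "x \<in> F" "y \<in> F" "x \<noteq> y" "z \<in> ball x (s / 2)" "z \<in> ball y (s / 2)"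
    then show "z \<in> {}"
      using F(3)[of x y] dist_triangle2[of x y z] by simp
  qed
  have B_le: "emeasure \<mu> (B y) \<le> ennreal (a * real (Suc p)) * emeasure \<mu> (ball y (s / 2))" if "y \<in> F" for y
  proof -
    have "emeasure \<mu> (B y) \<le> c y * (\<integral>\<^sup>+x. U y x * indicator (ball y s) x \<partial>\<mu>)"
      unfolding B_def by (rule nn_integral_Markov_inequality) measurable
    also have "\<dots> \<le> c y * of_nat (Suc p)"
      by (intro mult_left_mono return) simp
    also have "\<dots> \<le> (ennreal (a / K) * (ennreal K * emeasure \<mu> (ball y (s / 2)))) * of_nat (Suc p)"
      unfolding c_def using F(2) that by (intro mult_right_mono mult_left_mono) (auto simp: G_def)
    also have "\<dots> = (ennreal (a / K) * ennreal K * ennreal (real (Suc p))) * emeasure \<mu> (ball y (s / 2))"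
      by (simp only: ennreal_of_nat_eq_real_of_nat mult_ac)
    also have "ennreal (a / K) * ennreal K * ennreal (real (Suc p)) = ennreal (a * real (Suc p))"
      using assms by (simp add: ennreal_mult[symmetric] del: of_nat_Suc)
    finally show ?thesis .
  qed
  show ?thesis
  proof (rule that)
    show "(\<Union>y\<in>F. B y) \<in> sets \<mu>"
      using F(1) by (intro sets.finite_UN) auto
    have "emeasure \<mu> (\<Union>y\<in>F. B y) \<le> (\<Sum>y\<in>F. emeasure \<mu> (B y))"
      using F(1) by (intro emeasure_subadditive_finite) auto
    also have "\<dots> \<le> (\<Sum>y\<in>F. ennreal (a * real (Suc p)) * emeasure \<mu> (ball y (s / 2)))"
      by (intro sum_mono B_le)
    also have "\<dots> = ennreal (a * real (Suc p)) * emeasure \<mu> (\<Union>y\<in>F. ball y (s / 2))"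
      using F(1) disjoint by (subst sum_emeasure[symmetric]) (auto simp: sum_distrib_left)
    also have "\<dots> \<le> ennreal (a * real (Suc p)) * 1"
      by (intro mult_left_mono \<mu>.emeasure_le_1) simp
    finally show "emeasure \<mu> (\<Union>y\<in>F. B y) \<le> ennreal (a * real (Suc p))"
      by simp
  next
    fix x assume x: "x \<notin> (\<Union>y\<in>F. B y)"
      "emeasure \<mu> (ball x (2 * s)) \<le> ennreal K * emeasure \<mu> (ball x (s / 2))"
    then obtain y where y: "y \<in> F" "x \<in> ball y s"
      using F(4) by (auto simp: G_def)
    let ?R = "annealed_return_time P \<theta> T (2 * s) p x"
    have "?R \<le> U y x"
      unfolding annealed_return_time_def U_def
      using y by (intro nn_integral_mono return_time_le_late_visit_time)
    moreover have "ball x s \<subseteq> ball y (2 * s)"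
    proof
      fix z assume "z \<in> ball x s"
      then show "z \<in> ball y (2 * s)"
        using y(2) dist_triangle[of y z x] by simp
    qed
    then have "emeasure \<mu> (ball x s) \<le> emeasure \<mu> (ball y (2 * s))"
      by (intro emeasure_mono) auto
    ultimately have "ennreal (a / K) * (?R * emeasure \<mu> (ball x s)) \<le> c y * U y x"
      unfolding c_def by (subst mult.commute[of ?R]) (auto simp: mult.assoc intro!: mult_mono)
    also have "\<dots> \<le> 1"
      using x(1) y by (auto simp: B_def not_le)
    finally have "ennreal (K / a) * (ennreal (a / K) * (?R * emeasure \<mu> (ball x s))) \<le> ennreal (K / a) * 1"
      by (rule mult_left_mono) simp
    moreover have "ennreal (K / a) * ennreal (a / K) = 1"
      using assms by (simp add: ennreal_mult[symmetric])
    ultimately show "?R * emeasure \<mu> (ball x s) \<le> ennreal (K / a)"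
      by (simp add: mult.assoc[symmetric])
  qed
qed

text \<open>The exceptional sets at the radii \<open>(1/2) ^ (n + 1)\<close> are summable with \<open>a = 1 / (n + 1)^2\<close>. The
  price is a polynomial factor in \<open>n\<close>, which is invisible on the logarithmic scale. The doubling
  constant \<open>2 ^ q\<close> is left open because its choice will depend on the point.\<close>

lemma AE_return_time_at_doubling_scales:
  assumes compact: "compact (UNIV :: 'x set)"
  shows "AE x in \<mu>. \<forall>p q. \<forall>\<^sub>F n in sequentially.
    measure \<mu> (ball x ((1/2) ^ n)) \<le> 2 ^ q * measure \<mu> (ball x ((1/2) ^ (n + 2))) \<longrightarrow>
    annealed_return_time P \<theta> T ((1/2) ^ n) p x * ennreal (measure \<mu> (ball x ((1/2) ^ (n + 1))))
      \<le> ennreal (2 ^ q * (real n + 1) ^ 2)"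
proof (unfold AE_all_countable, intro allI)
  fix p q :: nat
  define a :: "nat \<Rightarrow> real" where "a n = 1 / (real n + 1) ^ 2" for n
  have a: "0 < a n" for n
    by (simp add: a_def add_nonneg_pos)
  define s :: "nat \<Rightarrow> real" where "s n = (1/2) ^ (n + 1)" for n
  have "\<exists>B. B \<in> sets \<mu> \<and> emeasure \<mu> B \<le> ennreal (a n * real (Suc p)) \<and>
    (\<forall>x. x \<notin> B \<longrightarrow> emeasure \<mu> (ball x (2 * s n)) \<le> ennreal (2 ^ q) * emeasure \<mu> (ball x (s n / 2)) \<longrightarrow>
      annealed_return_time P \<theta> T (2 * s n) p x * emeasure \<mu> (ball x (s n)) \<le> ennreal (2 ^ q / a n))" for n
  proof -
    have "0 < s n"
      by (simp add: s_def)
    then show ?thesis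
      using small_exceptional_set[OF compact _ _ a[of n], of "s n" "2 ^ q" p] by (metis zero_less_numeral zero_less_power)
  qed
  then obtain B where B: "\<And>n. B n \<in> sets \<mu>" "\<And>n. emeasure \<mu> (B n) \<le> ennreal (a n * real (Suc p))"
    "\<And>n x. x \<notin> B n \<Longrightarrow> emeasure \<mu> (ball x (2 * s n)) \<le> ennreal (2 ^ q) * emeasure \<mu> (ball x (s n / 2)) \<Longrightarrow>
      annealed_return_time P \<theta> T (2 * s n) p x * emeasure \<mu> (ball x (s n)) \<le> ennreal (2 ^ q / a n)"
    by metis
  have "summable (\<lambda>n. inverse (real (Suc n) ^ 2))"
    using inverse_power_summable[of 2, where 'a=real] by (subst summable_Suc_iff) simp
  then have "summable (\<lambda>n. a n * real (Suc p))"
    unfolding a_def by (intro summable_mult2) (simp add: inverse_eq_divide add.commute)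
  then have "summable (\<lambda>n. measure \<mu> (B n))"
  proof (rule summable_comparison_test'[where N = 0])
    fix n
    show "norm (measure \<mu> (B n)) \<le> a n * real (Suc p)"
      using B(2)[of n] a[of n] by (simp add: \<mu>.emeasure_eq_measure)
  qed
  then have "AE x in \<mu>. \<forall>\<^sub>F n in sequentially. x \<in> space \<mu> - B n"
    using B(1) by (intro borel_cantelli_AE1) (simp_all add: \<mu>.emeasure_eq_measure)
  then show "AE x in \<mu>. \<forall>\<^sub>F n in sequentially.
    measure \<mu> (ball x ((1/2) ^ n)) \<le> 2 ^ q * measure \<mu> (ball x ((1/2) ^ (n + 2))) \<longrightarrow>
    annealed_return_time P \<theta> T ((1/2) ^ n) p x * ennreal (measure \<mu> (ball x ((1/2) ^ (n + 1))))
      \<le> ennreal (2 ^ q * (real n + 1) ^ 2)"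
  proof (eventually_elim, elim eventually_mono, intro impI)
    fix x n
    assume "x \<in> space \<mu> - B n"
      "measure \<mu> (ball x ((1/2) ^ n)) \<le> 2 ^ q * measure \<mu> (ball x ((1/2) ^ (n + 2)))"
    moreover have "2 * s n = (1/2) ^ n" "s n / 2 = (1/2) ^ (n + 2)" "2 ^ q / a n = 2 ^ q * (real n + 1) ^ 2"
      by (simp_all add: s_def a_def)
    ultimately show "annealed_return_time P \<theta> T ((1/2) ^ n) p x * ennreal (measure \<mu> (ball x ((1/2) ^ (n + 1))))
      \<le> ennreal (2 ^ q * (real n + 1) ^ 2)"
      using B(3)[of x n]
      by (simp add: \<mu>.emeasure_eq_measure ennreal_mult[symmetric] s_def del: power_Suc)
  qed
qed

end

section \<open>Finding a doubling scale\<close>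

lemma iterated_growth_le:
  fixes b :: "nat \<Rightarrow> real"
  assumes "b a \<le> 1" "0 \<le> K" "\<And>i. i < j \<Longrightarrow> K * b (a + 2 * i + 2) \<le> b (a + 2 * i)"
  shows "K ^ j * b (a + 2 * j) \<le> 1"
  using assms(3)
proof (induction j)
  case 0
  then show ?case using assms(1) by simp
next
  case (Suc j)
  have "K ^ Suc j * b (a + 2 * Suc j) = K ^ j * (K * b (a + 2 * j + 2))"
    by (simp add: algebra_simps)
  also have "\<dots> \<le> K ^ j * b (a + 2 * j)"
    using Suc.prems assms(2) by (intro mult_left_mono) simp_all
  also have "\<dots> \<le> 1"
    using Suc by simp
  finally show ?case .
qed

text \<open>With \<open>l = - log 2 r\<close>, the dyadic radii between \<open>r powr c\<close> and \<open>r\<close> have the exponents from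
  \<open>a\<close> to \<open>L\<close> below, and \<open>L - a\<close> is about \<open>(c - 1) * l\<close>. The doubling condition compares exponents
  that differ by \<open>2\<close>, so if it failed throughout, the mass would drop by \<open>2 ^ q\<close> about
  \<open>(c - 1) * l / 2\<close> times. The assumption \<open>large\<close>, where the \<open>3\<close> absorbs the roundings, makes this too
  small to be compatible with \<open>mass\<close>.\<close>

lemma doubling_scale_exists:
  fixes M :: "real \<Rightarrow> real"
  assumes M: "mono M" "\<And>r. M r \<le> 1" and "0 < D" "1 < c" "0 < r" "r < 1"
    and large: "c * D * log 2 (1 / r) \<le> real q * ((c - 1) * log 2 (1 / r) - 3) / 2"
    and mass: "r powr (c * D) < M (r powr c)"
  obtains n where "(1/2) ^ n \<le> r" "r powr c \<le> (1/2) ^ (n + 1)" "real n + 1 \<le> c * log 2 (1 / r)"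
    "M ((1/2) ^ n) \<le> 2 ^ q * M ((1/2) ^ (n + 2))"
proof -
  define l where "l = log 2 (1 / r)"
  have "0 < l"
    using assms by (simp add: l_def)
  have r: "r = 2 powr (- l)"
    using assms by (simp add: l_def powr_minus field_simps)
  have half: "(1/2 :: real) ^ n = 2 powr (- real n)" for n
    by (simp add: powr_minus powr_realpow power_one_over field_simps)
  define a where "a = nat \<lceil>l\<rceil>"
  define L where "L = nat \<lfloor>c * l\<rfloor>"
  define j where "j = (L - a) div 2"
  have "0 < c * D * l"
    using assms \<open>0 < l\<close> by simp
  then have "0 < real q * ((c - 1) * l - 3)"
    using large unfolding l_def by linarith
  then have "3 < (c - 1) * l"
    by (simp add: zero_less_mult_iff)
  then have cl: "l + 3 < c * l"
    by (simp add: algebra_simps)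
  have a: "l \<le> real a" "real a < l + 1"
    using \<open>0 < l\<close> unfolding a_def by linarith+
  have L: "real L \<le> c * l" "c * l < real L + 1"
    using \<open>0 < l\<close> cl unfolding L_def by linarith+
  have "a \<le> L"
    using a L cl by linarith
  then have j: "a + 2 * j \<le> L" "L \<le> a + 2 * j + 1"
    by (auto simp: j_def)
  have mono_b: "M ((1/2) ^ m) \<le> M ((1/2) ^ n)" if "n \<le> m" for m n
    using that by (intro monoD[OF M(1)] power_decreasing) auto
  have "\<exists>i<j. M ((1/2) ^ (a + 2 * i)) \<le> 2 ^ q * M ((1/2) ^ (a + 2 * i + 2))"
  proof (rule ccontr)
    assume "\<not> ?thesis"
    then have "(2 ^ q) ^ j * M ((1/2) ^ (a + 2 * j)) \<le> 1"
      using M(2) by (intro iterated_growth_le) (force simp: not_le)+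
    moreover have "r powr (c * D) < M ((1/2) ^ (a + 2 * j))"
    proof -
      have "r powr c = 2 powr (- (c * l))"
        by (subst r) (simp add: powr_powr mult.commute)
      also have "\<dots> \<le> (1/2) ^ L"
        using L by (simp add: half)
      finally have "M (r powr c) \<le> M ((1/2) ^ L)"
        by (intro monoD[OF M(1)])
      also have "\<dots> \<le> M ((1/2) ^ (a + 2 * j))"
        using j by (intro mono_b)
      finally show ?thesis
        using mass by simp
    qed
    ultimately have "(2 ^ q) ^ j * r powr (c * D) < 1"
      using mult_strict_left_mono[of "r powr (c * D)" "M ((1/2) ^ (a + 2 * j))" "(2 ^ q) ^ j"]
      by (meson order_less_le_trans zero_less_numeral zero_less_power)
    moreover have "(2 ^ q) ^ j * r powr (c * D) = 2 powr (real q * real j - c * D * l)"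
    proof -
      have "(2 ^ q) ^ j = 2 powr (real q * real j)"
        by (simp add: power_mult[symmetric] powr_realpow[symmetric] powr_powr)
      moreover have "r powr (c * D) = 2 powr (- (c * D * l))"
        by (subst r) (simp add: powr_powr mult_ac)
      ultimately show ?thesis
        by (simp add: powr_diff powr_minus field_simps)
    qed
    ultimately have "2 powr (real q * real j - c * D * l) < 2 powr 0"
      by simp
    then have "real q * real j < c * D * l"
      by (simp only: powr_less_cancel_iff)
    have "(c - 1) * l - 3 \<le> 2 * real j"
      using j(2) a(2) L(2) by (simp add: algebra_simps)
    then have "real q * ((c - 1) * l - 3) \<le> real q * (2 * real j)"
      by (intro mult_left_mono) simp_all
    with \<open>real q * real j < c * D * l\<close> show False
      using large unfolding l_def by simp
  qed
  then obtain i where i: "i < j" "M ((1/2) ^ (a + 2 * i)) \<le> 2 ^ q * M ((1/2) ^ (a + 2 * i + 2))"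
    by blast
  have n: "a + 2 * i + 1 \<le> L"
    using i j by simp
  show ?thesis
  proof (rule that[of "a + 2 * i"])
    show "(1/2) ^ (a + 2 * i) \<le> r"
      unfolding half using a by (subst r) simp
    have "real (a + 2 * i + 1) \<le> c * l"
      using n L by linarith
    then show "real (a + 2 * i) + 1 \<le> c * log 2 (1 / r)" "r powr c \<le> (1/2) ^ (a + 2 * i + 1)"
      unfolding half l_def[symmetric] by (simp, subst r, simp add: powr_powr mult.commute)
  qed (use i in simp)
qed

section \<open>Return rates against dimension quotients at a point\<close>

lemma ext_ln_mono: "s \<le> t \<Longrightarrow> ext_ln s \<le> ext_ln t"
  by (cases s; cases t) (auto simp: ext_ln_def ennreal_eq_0_iff top_unique)

lemma ext_ln_ennreal: "0 < y \<Longrightarrow> ext_ln (ennreal y) = ereal (ln y)"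
  by (simp add: ext_ln_def ennreal_eq_0_iff)

lemma ereal_divide_neg_less_iff:
  "x / ereal y < ereal z \<longleftrightarrow> ereal (z * y) < x" if "y < 0"
  using that by (cases x) (auto simp: field_simps)

lemma powr_less_of_ext_ln_less:
  assumes "ext_ln (ennreal m) / ereal (ln r) < ereal D" "0 < r" "r < 1"
  shows "r powr D < m"
proof -
  have "ereal (D * ln r) < ext_ln (ennreal m)"
    using assms by (simp add: ereal_divide_neg_less_iff)
  then have "0 < m" "D * ln r < ln m"
    by (cases "0 < m"; simp add: ext_ln_ennreal; simp add: ext_ln_def ennreal_neg)+
  have "r powr D = exp (D * ln r)"
    using \<open>0 < r\<close> by (simp add: powr_def)
  also have "\<dots> < exp (ln m)"
    using \<open>D * ln r < ln m\<close> by (simp only: exp_less_cancel_iff)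
  also have "\<dots> = m"
    using \<open>0 < m\<close> by simp
  finally show ?thesis .
qed

text \<open>The situation at a typical point: \<open>M r\<close> is the mass of the ball of radius \<open>r\<close>, and \<open>R r\<close> is the
  annealed return time for a fixed delay.\<close>

locale doubling_return_bound =
  fixes R :: "real \<Rightarrow> ennreal" and M :: "real \<Rightarrow> real"
  assumes antimono_R: "antimono R"
    and mono_M: "mono M" and M_le_1: "M r \<le> 1"
    and at_doubling_scales: "\<forall>\<^sub>F n in sequentially. M ((1/2) ^ n) \<le> 2 ^ q * M ((1/2) ^ (n + 2)) \<longrightarrow>
      R ((1/2) ^ n) * ennreal (M ((1/2) ^ (n + 1))) \<le> ennreal (2 ^ q * (real n + 1) ^ 2)"
begin

text \<open>The doubling scale \<open>(1/2) ^ n\<close> lies below \<open>r\<close>, so \<open>R r\<close> is at most the return time there,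
  and above \<open>r powr c\<close>, so the mass there is at least \<open>r powr (c * D)\<close>. The gap between \<open>c * D\<close>
  and \<open>D'\<close> swallows the factor \<open>2 ^ q * (n + 1)^2\<close>, because \<open>n\<close> is only of the order of \<open>- ln r\<close>.\<close>

lemma eventually_return_rate_le:
  assumes "0 < D" "1 < c" "c * D < D'"
  shows "\<forall>\<^sub>F r in at_right 0. ext_ln (ennreal (M (r powr c))) / ereal (ln (r powr c)) < ereal D \<longrightarrow>
    ext_ln (R r) / ereal (- ln r) \<le> ereal D'"
proof -
  \<comment> \<open>Each failure of doubling costs a factor \<open>2 ^ q\<close>, and there are about \<open>(c - 1) / 2\<close> times
    \<open>- log 2 r\<close> of them at stake: this \<open>q\<close> makes the total loss exceed \<open>r powr (c * D)\<close>.\<close>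
  obtain q :: nat where "2 * c * D / (c - 1) < real q"
    using reals_Archimedean2 by blast
  then have q: "0 < real q * (c - 1) / 2 - c * D"
    using assms by (simp add: field_simps)
  obtain N where N: "\<And>n. N \<le> n \<Longrightarrow> M ((1/2) ^ n) \<le> 2 ^ q * M ((1/2) ^ (n + 2)) \<Longrightarrow>
      R ((1/2) ^ n) * ennreal (M ((1/2) ^ (n + 1))) \<le> ennreal (2 ^ q * (real n + 1) ^ 2)"
    using at_doubling_scales[of q] unfolding eventually_sequentially by blast
  have "filterlim (\<lambda>r. log 2 (1 / r)) at_top (at_right (0 :: real))"
    by real_asymp
  then have "\<forall>\<^sub>F r in at_right 0. 3 * real q / 2 / (real q * (c - 1) / 2 - c * D) \<le> log 2 (1 / r)"
    by (simp add: filterlim_at_top)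
  then have ev1: "\<forall>\<^sub>F r in at_right 0. c * D * log 2 (1 / r) \<le> real q * ((c - 1) * log 2 (1 / r) - 3) / 2"
    by eventually_elim (use q in \<open>simp add: field_simps\<close>)
  have "0 < D' - c * D" "0 < c" using assms by auto
  then have "((\<lambda>r. 2 ^ q * (c * log 2 (1 / r)) ^ 2 * r powr (D' - c * D)) \<longlongrightarrow> 0) (at_right 0)"
    by real_asymp
  then have ev2: "\<forall>\<^sub>F r in at_right 0. 2 ^ q * (c * log 2 (1 / r)) ^ 2 * r powr (D' - c * D) < 1"
    by (rule order_tendstoD) simp
  have ev3: "\<forall>\<^sub>F r in at_right 0. 0 < r \<and> r < 1 \<and> r < (1/2 :: real) ^ N"
    by (intro eventually_conj eventually_at_right_less eventually_at_right_real[THEN eventually_mono]) auto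
  show ?thesis
    using ev1 ev2 ev3
  proof (eventually_elim, intro impI)
    fix r :: real
    assume large: "c * D * log 2 (1 / r) \<le> real q * ((c - 1) * log 2 (1 / r) - 3) / 2"
      and small: "2 ^ q * (c * log 2 (1 / r)) ^ 2 * r powr (D' - c * D) < 1"
      and r: "0 < r \<and> r < 1 \<and> r < (1/2) ^ N"
      and rate: "ext_ln (ennreal (M (r powr c))) / ereal (ln (r powr c)) < ereal D"
    have "0 < r powr c" "r powr c < 1"
      using r assms powr_less_mono2[of c r 1] by simp_all
    then have mass: "r powr (c * D) < M (r powr c)"
      using powr_less_of_ext_ln_less[OF rate] by (simp add: powr_powr)
    obtain n where n: "(1/2) ^ n \<le> r" "r powr c \<le> (1/2) ^ (n + 1)" "real n + 1 \<le> c * log 2 (1 / r)"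
      "M ((1/2) ^ n) \<le> 2 ^ q * M ((1/2) ^ (n + 2))"
      using doubling_scale_exists[OF mono_M M_le_1 assms(1,2) _ _ large mass] r by blast
    have "(1/2 :: real) ^ n < (1/2) ^ N"
      using n(1) r by linarith
    then have "N \<le> n"
      by simp
    have "R r * ennreal (r powr (c * D)) \<le> R ((1/2) ^ n) * ennreal (M ((1/2) ^ (n + 1)))"
      using n(1,2) mass monoD[OF mono_M n(2)]
      by (intro mult_mono antimonoD[OF antimono_R] ennreal_leI) auto
    also have "\<dots> \<le> ennreal (2 ^ q * (real n + 1) ^ 2)"
      using N[OF \<open>N \<le> n\<close> n(4)] .
    also have "\<dots> \<le> ennreal (2 ^ q * (c * log 2 (1 / r)) ^ 2)"
      using n(3) by (intro ennreal_leI mult_left_mono power_mono) auto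
    also have "\<dots> \<le> ennreal (r powr (c * D - D'))"
    proof (rule ennreal_leI)
      have "2 ^ q * (c * log 2 (1 / r)) ^ 2 * r powr (D' - c * D) * r powr (c * D - D') \<le> 1 * r powr (c * D - D')"
        using small by (intro mult_right_mono) auto
      moreover have "r powr (D' - c * D) * r powr (c * D - D') = 1"
        using r by (simp add: powr_add[symmetric])
      ultimately show "2 ^ q * (c * log 2 (1 / r)) ^ 2 \<le> r powr (c * D - D')"
        by (simp add: mult.assoc)
    qed
    finally have "R r * ennreal (r powr (c * D)) * ennreal (r powr (- (c * D)))
        \<le> ennreal (r powr (c * D - D')) * ennreal (r powr (- (c * D)))"
      by (rule mult_right_mono) simp
    moreover have "ennreal (r powr (c * D)) * ennreal (r powr (- (c * D))) = 1"
      "ennreal (r powr (c * D - D')) * ennreal (r powr (- (c * D))) = ennreal (r powr (- D'))"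
      using r by (simp_all add: ennreal_mult[symmetric] powr_add[symmetric])
    ultimately have "R r \<le> ennreal (r powr (- D'))"
      by (simp add: mult.assoc)
    then have "ext_ln (R r) \<le> ext_ln (ennreal (r powr (- D')))"
      by (rule ext_ln_mono)
    also have "\<dots> = ereal (- D' * ln r)"
      using r by (simp add: ext_ln_ennreal ln_powr)
    finally show "ext_ln (R r) / ereal (- ln r) \<le> ereal D'"
      using r by (subst ereal_divide_le_pos) (auto simp: mult.commute)
  qed
qed

lemma Liminf_local_dim_nonneg: "0 \<le> Liminf (at_right 0) (\<lambda>r. ext_ln (ennreal (M r)) / ereal (ln r))"
proof (rule Liminf_bounded)
  have "\<forall>\<^sub>F r :: real in at_right 0. 0 < r \<and> r < 1"
    by (intro eventually_conj eventually_at_right_less eventually_at_right_real[THEN eventually_mono]) auto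
  then show "\<forall>\<^sub>F r in at_right 0. 0 \<le> ext_ln (ennreal (M r)) / ereal (ln r)"
  proof eventually_elim
    fix r :: real assume r: "0 < r \<and> r < 1"
    show "0 \<le> ext_ln (ennreal (M r)) / ereal (ln r)"
      using r M_le_1[of r]
      by (cases "0 < M r") (auto simp: ext_ln_ennreal divide_nonpos_neg, auto simp: ext_ln_def ennreal_neg)
  qed
qed

lemma between_rates:
  assumes "0 \<le> (d :: ereal)" "d < ereal D'"
  obtains D c where "d < ereal D" "0 < D" "1 < c" "c * D < D'"
proof -
  obtain D where D: "d < ereal D" "ereal D < ereal D'"
    using ereal_dense2[OF assms(2)] by blast
  then have "0 < D"
    using assms(1) order.strict_trans1[of 0 d "ereal D"] by simp
  show ?thesis
    using D \<open>0 < D\<close> by (intro that[of D "(1 + D' / D) / 2"]) (auto simp: field_simps)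
qed

lemma Limsup_return_rate_le:
  "Limsup (at_right 0) (\<lambda>r. ext_ln (R r) / ereal (- ln r))
    \<le> Limsup (at_right 0) (\<lambda>r. ext_ln (ennreal (M r)) / ereal (ln r))"
proof (rule dense_ge)
  let ?f = "\<lambda>r. ext_ln (ennreal (M r)) / ereal (ln r)"
  fix y assume y: "Limsup (at_right 0) ?f < y"
  have nonneg: "0 \<le> Limsup (at_right 0) ?f"
    using Liminf_local_dim_nonneg Liminf_le_Limsup[of "at_right (0::real)" ?f] by (meson order_trans trivial_limit_at_right_real)
  show "Limsup (at_right 0) (\<lambda>r. ext_ln (R r) / ereal (- ln r)) \<le> y"
  proof (cases y)
    case (real D')
    obtain D c where D: "Limsup (at_right 0) ?f < ereal D" "0 < D" "1 < c" "c * D < D'"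
      using between_rates[OF nonneg y[unfolded real]] by blast
    have "filterlim (\<lambda>r. r powr c) (at_right 0) (at_right (0 :: real))"
      using D by real_asymp
    then have "\<forall>\<^sub>F r in at_right 0. ?f (r powr c) < ereal D"
      unfolding filterlim_iff using Limsup_lessD[OF D(1)] by blast
    then have "\<forall>\<^sub>F r in at_right 0. ext_ln (R r) / ereal (- ln r) \<le> ereal D'"
      using eventually_return_rate_le[OF D(2-4)] by eventually_elim blast
    then show ?thesis
      unfolding real by (rule Limsup_bounded)
  qed (use y in auto)
qed

lemma Liminf_return_rate_le:
  "Liminf (at_right 0) (\<lambda>r. ext_ln (R r) / ereal (- ln r))
    \<le> Liminf (at_right 0) (\<lambda>r. ext_ln (ennreal (M r)) / ereal (ln r))"
proof (rule dense_ge)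
  let ?f = "\<lambda>r. ext_ln (ennreal (M r)) / ereal (ln r)"
  fix y assume y: "Liminf (at_right 0) ?f < y"
  show "Liminf (at_right 0) (\<lambda>r. ext_ln (R r) / ereal (- ln r)) \<le> y"
  proof (cases y)
    case (real D')
    obtain D c where D: "Liminf (at_right 0) ?f < ereal D" "0 < D" "1 < c" "c * D < D'"
      using between_rates[OF Liminf_local_dim_nonneg y[unfolded real]] by blast
    \<comment> \<open>A lower limit gives good radii only along some sequence \<open>\<rho> \<rightarrow> 0\<close>. They still have the form
      \<open>r powr c\<close> because this map has an inverse near \<open>0\<close>.\<close>
    have root: "filterlim (\<lambda>r. r powr (1 / c)) (at_right 0) (at_right (0 :: real))"
      using D by real_asymp
    have "\<exists>\<^sub>F r in at_right 0. ?f (r powr c) < ereal D"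
    proof (rule ccontr)
      assume "\<not> ?thesis"
      then have "\<forall>\<^sub>F r in at_right 0. \<not> ?f ((r powr (1 / c)) powr c) < ereal D"
        using root unfolding not_frequently filterlim_iff by blast
      then have "\<forall>\<^sub>F r in at_right 0. ereal D \<le> ?f r"
        using eventually_at_right_less[of 0]
      proof eventually_elim
        fix r :: real assume "0 < r" "\<not> ?f ((r powr (1 / c)) powr c) < ereal D"
        moreover have "(r powr (1 / c)) powr c = r"
          using \<open>0 < r\<close> D by (simp add: powr_powr)
        ultimately show "ereal D \<le> ?f r"
          by (simp only: not_less)
      qed
      then have "ereal D \<le> Liminf (at_right 0) ?f"
        by (rule Liminf_bounded)
      then show False
        using D(1) by (meson leD)
    qed
    then have "\<exists>\<^sub>F r in at_right 0. ext_ln (R r) / ereal (- ln r) \<le> ereal D'"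
      by (rule frequently_rev_mp) (rule eventually_return_rate_le[OF D(2-4)])
    then show ?thesis
      unfolding real by (auto simp: frequently_def not_le dest: less_LiminfD intro: leI)
  qed (use y in auto)
qed

end


section \<open>The limit over the delay\<close>

text \<open>The value of \<open>lim\<close> is arbitrary unless the sequence converges; monotonicity in the delay is
  what makes the limit in the recurrence rates meaningful.\<close>

lemma lim_incseq_le:
  fixes f :: "nat \<Rightarrow> ereal"
  assumes "incseq f" "\<And>p. f p \<le> d"
  shows "lim f \<le> d"
proof -
  have "lim f = (SUP p. f p)"
    using LIMSEQ_SUP[OF assms(1)] by (rule limI)
  then show ?thesis
    using assms(2) by (simp add: SUP_least)
qed

lemma return_time_antimono_radius: "r \<le> r' \<Longrightarrow> return_time \<theta> T r' p \<omega> x \<le> return_time \<theta> T r p \<omega> x"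
  unfolding return_time_def by (rule INF_superset_mono) auto

lemma return_time_mono_delay: "p \<le> p' \<Longrightarrow> return_time \<theta> T r p \<omega> x \<le> return_time \<theta> T r p' \<omega> x"
  unfolding return_time_def by (rule INF_superset_mono) auto

lemma eventually_log_annealed_return_time_mono_delay:
  assumes "p \<le> p'"
  shows "\<forall>\<^sub>F r in at_right 0. ext_ln (annealed_return_time P \<theta> T r p x) / ereal (- ln r)
    \<le> ext_ln (annealed_return_time P \<theta> T r p' x) / ereal (- ln r)"
proof -
  have "\<forall>\<^sub>F r :: real in at_right 0. 0 < r \<and> r < 1"
    by (intro eventually_conj eventually_at_right_less eventually_at_right_real[THEN eventually_mono]) auto
  then show ?thesis
  proof eventually_elim
    fix r :: real assume "0 < r \<and> r < 1"
    then show "ext_ln (annealed_return_time P \<theta> T r p x) / ereal (- ln r)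
      \<le> ext_ln (annealed_return_time P \<theta> T r p' x) / ereal (- ln r)"
      unfolding annealed_return_time_def
      by (intro ereal_divide_right_mono ext_ln_mono nn_integral_mono return_time_mono_delay assms) simp
  qed
qed

theorem theorem17:
  fixes P :: "'w::metric_space measure"
    and \<theta> :: "'w \<Rightarrow> 'w"
    and T :: "'w \<Rightarrow> 'x::metric_space \<Rightarrow> 'x"
    and \<mu> :: "'x measure"
    and \<A> :: "('x, 'e::euclidean_space) chart set"
    and g :: "('x, 'e) metric_tensor"
  assumes "compact_riemannian_manifold \<A> g"
    and "random_dynamical_system P \<theta> T"
    and "stationary_measure P \<theta> T \<mu>"
  shows "AE x in \<mu>. lower_recurrence_rate P \<theta> T x \<le> lower_local_dim \<mu> x \<and>
                    upper_recurrence_rate P \<theta> T x \<le> upper_local_dim \<mu> x"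
proof -
  interpret stationary_rds P \<theta> T \<mu>
    using assms(2,3) by unfold_locales
  have "compact (UNIV :: 'x set)"
    using assms(1) by (simp add: compact_riemannian_manifold_def)
  from AE_return_time_at_doubling_scales[OF this] show ?thesis
  proof eventually_elim
    fix x
    assume scales: "\<forall>p q. \<forall>\<^sub>F n in sequentially.
      measure \<mu> (ball x ((1/2) ^ n)) \<le> 2 ^ q * measure \<mu> (ball x ((1/2) ^ (n + 2))) \<longrightarrow>
      annealed_return_time P \<theta> T ((1/2) ^ n) p x * ennreal (measure \<mu> (ball x ((1/2) ^ (n + 1))))
        \<le> ennreal (2 ^ q * (real n + 1) ^ 2)"
    have bound: "doubling_return_bound (\<lambda>r. annealed_return_time P \<theta> T r p x) (\<lambda>r. measure \<mu> (ball x r))" for p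
    proof
      show "antimono (\<lambda>r. annealed_return_time P \<theta> T r p x)"
        unfolding annealed_return_time_def
        by (intro antimonoI nn_integral_mono return_time_antimono_radius)
      show "mono (\<lambda>r. measure \<mu> (ball x r))"
        by (intro monoI \<mu>.finite_measure_mono subset_ball) (simp_all add: sets_\<mu>)
    qed (use scales in auto)
    have "lower_recurrence_rate P \<theta> T x \<le> lower_local_dim \<mu> x"
      unfolding lower_recurrence_rate_def lower_local_dim_def \<mu>.emeasure_eq_measure
      by (intro lim_incseq_le incseq_SucI Liminf_mono eventually_log_annealed_return_time_mono_delay
          doubling_return_bound.Liminf_return_rate_le[OF bound]) simp
    moreover have "upper_recurrence_rate P \<theta> T x \<le> upper_local_dim \<mu> x"
      unfolding upper_recurrence_rate_def upper_local_dim_def \<mu>.emeasure_eq_measure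
      by (intro lim_incseq_le incseq_SucI Limsup_mono eventually_log_annealed_return_time_mono_delay
          doubling_return_bound.Limsup_return_rate_le[OF bound]) simp
    ultimately show "lower_recurrence_rate P \<theta> T x \<le> lower_local_dim \<mu> x \<and>
        upper_recurrence_rate P \<theta> T x \<le> upper_local_dim \<mu> x" ..
  qed
qed

end
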